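(* Let $\mathcal X$ be a $C^r$ vector field, $r\ge2$, near the origin of $\mathbb R^2$ with $\mathcal X(0)=0$ and $A:=D\mathcal X(0)$ satisfying $A\neq0$, $A^2=0$, and suppose its distinguished restriction $\mathcal R_{\mathcal X}$ is rational. Then the recurrence degree $d_{\mathcal X}$ is independent of the Jordan chain of $A$ used to define the distinguished restriction.
   Context: A Jordan chain of $A$ is a pair $(q_0,q_1)$ with $q_0\ne0$, $Aq_0=0$, $Aq_1=q_0$. Since $\ker A=\operatorname{im}A=\operatorname{span}\{q_0\}$, there is a unique scalar function $\mathcal R_{\mathcal X}$ near $0$ with $A\mathcal X(uq_0)=\mathcal R_{\mathcal X}(u)q_0$, the distinguished restriction associated with the chain; it satisfies $\mathcal R_{\mathcal X}(0)=\mathcal R_{\mathcal X}'(0)=0$. It is called rational if it coincides near $0$ with a real rational function. If $\mathcal R_{\mathcal X}$ is rational and not identically zero, write $\mathcal R_{\mathcal X}(u)=u^2P(u)/Q(u)$ with real polynomials $P,Q$, $\gcd(P,Q)=1$, $Q(0)\neq0$. The polynomial $Q$ (unique up to a nonzero constant factor) is the minimal denominator, and $d_{\mathcal X}:=\deg Q$ is the recurrence degree (so $d_{\mathcal X}=0$ if $\mathcal R_{\mathcal X}/u^2$ is a polynomial). For the identically zero restriction, $d_{\mathcal X}:=0$. *)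

theory Defs
  imports "HOL-Analysis.Analysis" "HOL-Computational_Algebra.Polynomial" "HOL-Library.Extended_Nat"
begin

primrec k_times_cont_diff_on ::
    "nat \<Rightarrow> ('a::real_normed_vector \<Rightarrow> 'b::real_normed_vector) \<Rightarrow> 'a set \<Rightarrow> bool" where
  "k_times_cont_diff_on 0 f U \<longleftrightarrow> continuous_on U f"
| "k_times_cont_diff_on (Suc k) f U \<longleftrightarrow>
     (\<forall>x\<in>U. f differentiable (at x)) \<and>
     (\<forall>v. k_times_cont_diff_on k (\<lambda>x. frechet_derivative f (at x) v) U)"

text \<open>The case \<open>r = \<infinity>\<close> is the smooth one.\<close>

definition C_r_on ::
    "enat \<Rightarrow> ('a::real_normed_vector \<Rightarrow> 'b::real_normed_vector) \<Rightarrow> 'a set \<Rightarrow> bool" where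
  "C_r_on r f U \<longleftrightarrow> (\<forall>k. enat k \<le> r \<longrightarrow> k_times_cont_diff_on k f U)"

definition jordan_chain :: "real^2^2 \<Rightarrow> real^2 \<Rightarrow> real^2 \<Rightarrow> bool" where
  "jordan_chain A q0 q1 \<longleftrightarrow> q0 \<noteq> 0 \<and> A *v q0 = 0 \<and> A *v q1 = q0"

text \<open>
  The restriction associated with a chain \<open>(q0, q1)\<close> depends on \<open>q0\<close> only. The description is
  proper at every \<open>u\<close>, because the image of \<open>A\<close> is the line spanned by \<open>q0\<close>; only the germ
  at \<open>0\<close> matters, since the vector field itself is meant as a germ at the origin.
\<close>

definition distinguished_restriction :: "(real^2 \<Rightarrow> real^2) \<Rightarrow> real^2 \<Rightarrow> real \<Rightarrow> real" where
  "distinguished_restriction X q0 u =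
     (THE c. jacobian X (at 0) *v X (u *\<^sub>R q0) = c *\<^sub>R q0)"

text \<open>
  A rational function that coincides with \<open>R\<close> near \<open>0\<close> has to be defined at \<open>0\<close>, so it has a
  denominator not vanishing there.
\<close>

definition rational_near_0 :: "(real \<Rightarrow> real) \<Rightarrow> bool" where
  "rational_near_0 R \<longleftrightarrow>
     (\<exists>P Q :: real poly. poly Q 0 \<noteq> 0 \<and> (\<forall>\<^sub>F u in nhds 0. R u = poly P u / poly Q u))"

definition minimal_denominator :: "(real \<Rightarrow> real) \<Rightarrow> real poly \<Rightarrow> bool" where
  "minimal_denominator R Q \<longleftrightarrow>
     (\<exists>P. coprime P Q \<and> poly Q 0 \<noteq> 0 \<and>
          (\<forall>\<^sub>F u in nhds 0. R u = u\<^sup>2 * poly P u / poly Q u))"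

text \<open>
  Meaningful for \<open>R\<close> rational near \<open>0\<close> with \<open>R 0 = 0\<close> and vanishing derivative at \<open>0\<close>:
  then a minimal denominator exists and is unique up to a nonzero constant factor.
\<close>

definition recurrence_degree :: "(real \<Rightarrow> real) \<Rightarrow> nat" where
  "recurrence_degree R =
     (if \<forall>\<^sub>F u in nhds 0. R u = 0 then 0
      else (THE d. \<exists>Q. minimal_denominator R Q \<and> degree Q = d))"

end

theory Submission imports Defs begin

text \<open>
  The image and the kernel of \<open>A\<close> are lines, spanned by the first vector of any Jordan chain.
  Two chains thus begin with proportional vectors, \<open>p0 = k q0\<close> with \<open>k \<noteq> 0\<close>
  (\<open>jordan_chain_scale\<close>), and comparing the two defining equations
  of \<open>A X(u k q0)\<close> shows that the two restrictions are conjugate by a homothety: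
  \<open>R_p(u) = R_q(k u) / k\<close> (\<open>distinguished_restriction_scale\<close>).

  The substitution \<open>u \<mapsto> k u\<close> is an automorphism of the ring of real polynomials that preserves
  degrees, coprimality and non-vanishing at \<open>0\<close>. It turns \<open>u\<^sup>2 P(u) / Q(u)\<close> into
  \<open>u\<^sup>2 (k P(k u)) / Q(k u)\<close>, hence a minimal denominator into a minimal denominator of the same
  degree (\<open>minimal_denominator_homothety\<close>). The inverse homothety gives the converse, so the
  degrees of the minimal denominators form the same set for both restrictions.
\<close>

lemma jordan_chain_spans:
  fixes v :: "real^2"
  assumes "jordan_chain A q0 q1"
  obtains a b where "v = a *\<^sub>R q0 + b *\<^sub>R q1"
proof -
  have q: "q0 \<noteq> 0" "A *v q0 = 0" "A *v q1 = q0"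
    using assms by (auto simp: jordan_chain_def)
  \<comment> \<open>\<open>A\<close> maps the line of \<open>q0\<close> to \<open>0\<close>, but not \<open>q1\<close>.\<close>
  have "A *v (c *\<^sub>R q0) = 0" for c
    using q(2) by (simp add: matrix_vector_mult_scaleR)
  then have "q1 \<notin> span {q0}"
    unfolding span_singleton using q(1,3) by (metis imageE)
  then have ind: "independent {q1, q0}" and ne: "q1 \<noteq> q0"
    using q(1) by (auto simp: independent_insert span_base)
  have "span {q1, q0} = (UNIV :: (real^2) set)"
    using ind ne card_ge_dim_independent[OF subset_UNIV ind] by auto
  then have "v \<in> span {q1, q0}" by simp
  then obtain b a where "v - b *\<^sub>R q1 = a *\<^sub>R q0"
    by (auto simp: span_insert span_singleton)
  then have "v = a *\<^sub>R q0 + b *\<^sub>R q1"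
    by (simp add: algebra_simps)
  then show thesis by (rule that)
qed

lemma jordan_chain_image:
  assumes "jordan_chain A q0 q1"
  obtains c where "A *v v = c *\<^sub>R q0"
proof -
  obtain a b where "v = a *\<^sub>R q0 + b *\<^sub>R q1"
    using jordan_chain_spans[OF assms] .
  then have "A *v v = b *\<^sub>R q0"
    using assms by (simp add: jordan_chain_def matrix_vector_right_distrib matrix_vector_mult_scaleR)
  then show thesis by (rule that)
qed

lemma jordan_chain_scale:
  assumes "jordan_chain A q0 q1" "jordan_chain A p0 p1"
  obtains k where "k \<noteq> 0" "p0 = k *\<^sub>R q0"
proof -
  obtain k where "A *v p1 = k *\<^sub>R q0"
    using jordan_chain_image[OF assms(1)] .
  then have "p0 = k *\<^sub>R q0" "k \<noteq> 0"
    using assms(2) by (auto simp: jordan_chain_def)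
  then show thesis using that by blast
qed

lemma distinguished_restriction_scale:
  assumes chain: "jordan_chain (jacobian X (at 0)) q0 q1" and k: "k \<noteq> 0"
  shows "distinguished_restriction X (k *\<^sub>R q0) u = distinguished_restriction X q0 (k * u) / k"
proof -
  have q0: "q0 \<noteq> 0" using chain by (simp add: jordan_chain_def)
  obtain c where c: "jacobian X (at 0) *v X ((k * u) *\<^sub>R q0) = c *\<^sub>R q0"
    using jordan_chain_image[OF chain] .
  have "distinguished_restriction X q0 (k * u) = c"
    unfolding distinguished_restriction_def using c q0 by auto
  moreover have "distinguished_restriction X (k *\<^sub>R q0) u = c / k"
    unfolding distinguished_restriction_def
    by (rule the_equality) (use c q0 k in \<open>auto simp: mult.commute\<close>)
  ultimately show ?thesis by simp
qed

lemma eventually_nhds_0_homothety: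
  fixes k :: real
  assumes "\<forall>\<^sub>F u in nhds 0. P u"
  shows "\<forall>\<^sub>F u in nhds 0. P (k * u)"
proof -
  have "filterlim (\<lambda>u. k * u) (nhds 0) (nhds 0)"
    by (auto intro!: tendsto_eq_intros filterlim_ident)
  then show ?thesis using assms by (rule eventually_compose_filterlim[rotated])
qed

lemma pcompose_homothety_inverse:
  fixes p :: "'a :: field poly"
  assumes "k \<noteq> 0"
  shows "(p \<circ>\<^sub>p [:0, k:]) \<circ>\<^sub>p [:0, inverse k:] = p"
  using assms by (simp add: pcompose_assoc[symmetric] pcompose_pCons)

lemma pcompose_dvd_pcompose:
  fixes p q r :: "'a :: comm_semiring_1 poly"
  assumes "p dvd q"
  shows "p \<circ>\<^sub>p r dvd q \<circ>\<^sub>p r"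
  using assms by (auto simp: pcompose_mult elim!: dvdE)

text \<open>A common divisor of the images pulls back, along the inverse homothety, to one of \<open>p\<close> and \<open>q\<close>.\<close>

lemma coprime_pcompose_homothety:
  fixes p q :: "'a :: field poly"
  assumes "coprime p q" and k: "k \<noteq> 0"
  shows "coprime (p \<circ>\<^sub>p [:0, k:]) (q \<circ>\<^sub>p [:0, k:])"
proof (rule coprimeI)
  fix d assume "d dvd p \<circ>\<^sub>p [:0, k:]" "d dvd q \<circ>\<^sub>p [:0, k:]"
  then have "d \<circ>\<^sub>p [:0, inverse k:] dvd p" "d \<circ>\<^sub>p [:0, inverse k:] dvd q"
    using pcompose_dvd_pcompose pcompose_homothety_inverse[OF k] by metis+
  then have "d \<circ>\<^sub>p [:0, inverse k:] dvd 1"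
    using assms(1) by (rule coprime_common_divisor[rotated])
  then have "(d \<circ>\<^sub>p [:0, inverse k:]) \<circ>\<^sub>p [:0, k:] dvd 1 \<circ>\<^sub>p [:0, k:]"
    by (rule pcompose_dvd_pcompose)
  then show "d dvd 1"
    using pcompose_homothety_inverse[of "inverse k" d] k by (simp add: pcompose_1)
qed

lemma rational_near_0_homothety:
  assumes "rational_near_0 R" and k: "k \<noteq> 0"
  shows "rational_near_0 (\<lambda>u. R (k * u) / k)"
proof -
  obtain P Q where Q: "poly Q 0 \<noteq> 0" and R: "\<forall>\<^sub>F u in nhds 0. R u = poly P u / poly Q u"
    using assms(1) unfolding rational_near_0_def by blast
  have "\<forall>\<^sub>F u in nhds 0. R (k * u) / k =
      poly (P \<circ>\<^sub>p [:0, k:]) u / poly (smult k (Q \<circ>\<^sub>p [:0, k:])) u"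
    using eventually_nhds_0_homothety[OF R, of k]
    by eventually_elim (simp add: poly_pcompose mult.commute)
  moreover have "poly (smult k (Q \<circ>\<^sub>p [:0, k:])) 0 \<noteq> 0"
    using Q k by (simp add: poly_pcompose)
  ultimately show ?thesis unfolding rational_near_0_def by blast
qed

lemma minimal_denominator_homothety:
  assumes "minimal_denominator R Q" and k: "k \<noteq> 0"
  shows "minimal_denominator (\<lambda>u. R (k * u) / k) (Q \<circ>\<^sub>p [:0, k:])"
proof -
  obtain P where cop: "coprime P Q" and Q: "poly Q 0 \<noteq> 0"
    and R: "\<forall>\<^sub>F u in nhds 0. R u = u\<^sup>2 * poly P u / poly Q u"
    using assms(1) unfolding minimal_denominator_def by blast
  \<comment> \<open>One factor \<open>k\<close> of \<open>(k u)\<^sup>2\<close> cancels the division by \<open>k\<close>; the other goes into the numerator.\<close>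
  have "\<forall>\<^sub>F u in nhds 0. R (k * u) / k =
      u\<^sup>2 * poly (smult k (P \<circ>\<^sub>p [:0, k:])) u / poly (Q \<circ>\<^sub>p [:0, k:]) u"
    using eventually_nhds_0_homothety[OF R, of k]
    by eventually_elim (use k in \<open>simp add: poly_pcompose power2_eq_square mult_ac\<close>)
  moreover have "coprime (smult k (P \<circ>\<^sub>p [:0, k:])) (Q \<circ>\<^sub>p [:0, k:])"
    using coprime_pcompose_homothety[OF cop k] k
    by (auto simp: coprime_def dvd_smult_iff)
  moreover have "poly (Q \<circ>\<^sub>p [:0, k:]) 0 \<noteq> 0"
    using Q by (simp add: poly_pcompose)
  ultimately show ?thesis unfolding minimal_denominator_def by blast
qed

text \<open>
  Both alternatives in the definition of the recurrence degree are carried over to the conjugate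
  germ, and carried back by the inverse homothety.
\<close>

lemma recurrence_degree_homothety:
  assumes k: "k \<noteq> 0"
  shows "recurrence_degree (\<lambda>u. R (k * u) / k) = recurrence_degree R"
proof -
  let ?S = "\<lambda>u. R (k * u) / k"
  have undo: "(\<lambda>u. ?S (inverse k * u) / inverse k) = R"
    using k by (simp add: fun_eq_iff mult.assoc[symmetric])
  have "(\<forall>\<^sub>F u in nhds 0. ?S u = 0) \<longleftrightarrow> (\<forall>\<^sub>F u in nhds 0. R u = 0)"
    using eventually_nhds_0_homothety[of "\<lambda>u. R u = 0" k]
      eventually_nhds_0_homothety[of "\<lambda>u. R (k * u) = 0" "inverse k"] k
    by (auto simp: mult.assoc[symmetric])
  moreover have "(\<exists>Q. minimal_denominator ?S Q \<and> degree Q = d) \<longleftrightarrow>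
      (\<exists>Q. minimal_denominator R Q \<and> degree Q = d)" for d
  proof
    assume "\<exists>Q. minimal_denominator ?S Q \<and> degree Q = d"
    then obtain Q where Q: "minimal_denominator ?S Q" "degree Q = d" by blast
    have "minimal_denominator R (Q \<circ>\<^sub>p [:0, inverse k:])"
      using minimal_denominator_homothety[OF Q(1), of "inverse k"] k unfolding undo by simp
    moreover have "degree (Q \<circ>\<^sub>p [:0, inverse k:]) = d"
      using Q(2) k by (simp add: degree_pcompose)
    ultimately show "\<exists>Q. minimal_denominator R Q \<and> degree Q = d" by blast
  next
    assume "\<exists>Q. minimal_denominator R Q \<and> degree Q = d"
    then obtain Q where Q: "minimal_denominator R Q" "degree Q = d" by blast
    have "minimal_denominator ?S (Q \<circ>\<^sub>p [:0, k:])"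
      using minimal_denominator_homothety[OF Q(1) k] .
    moreover have "degree (Q \<circ>\<^sub>p [:0, k:]) = d"
      using Q(2) k by (simp add: degree_pcompose)
    ultimately show "\<exists>Q. minimal_denominator ?S Q \<and> degree Q = d" by blast
  qed
  ultimately show ?thesis unfolding recurrence_degree_def by simp
qed

theorem proposition4p7:
  fixes X :: "real^2 \<Rightarrow> real^2" and r :: enat and U :: "(real^2) set"
    and q0 q1 p0 p1 :: "real^2"
  assumes "2 \<le> r"
    and "open U" and "0 \<in> U" and "C_r_on r X U"
    and "X 0 = 0"
    and "jacobian X (at 0) \<noteq> 0"
    and "jacobian X (at 0) ** jacobian X (at 0) = 0"
    and "jordan_chain (jacobian X (at 0)) q0 q1"
    and "rational_near_0 (distinguished_restriction X q0)"
    and "jordan_chain (jacobian X (at 0)) p0 p1"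
  shows "rational_near_0 (distinguished_restriction X p0) \<and>
         recurrence_degree (distinguished_restriction X p0) =
         recurrence_degree (distinguished_restriction X q0)"
proof -
  obtain k where k: "k \<noteq> 0" and p0: "p0 = k *\<^sub>R q0"
    using jordan_chain_scale[OF assms(8,10)] .
  have "distinguished_restriction X p0 = (\<lambda>u. distinguished_restriction X q0 (k * u) / k)"
    unfolding p0 using distinguished_restriction_scale[OF assms(8) k] by (rule ext)
  then show ?thesis
    using rational_near_0_homothety[OF assms(9) k] recurrence_degree_homothety[OF k] by simp
qed

end
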